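(* Let $L$ be a complete commutative residuated lattice, $X,A,A',A''$ $L$-enriched categories, $R\colon X\to A$, $R'\colon A\to A'$, $R''\colon A'\to A''$ $L$-enriched functors, and $\mu\colon X\to L$ an $L$-enriched functor. If $A$ is reducible to $A'$ along $R'$ with respect to $R$ and $\mu$, and $A'$ is reducible to $A''$ along $R''$ with respect to $R'\circ R$ and $\mu$, then $A$ is reducible to $A''$ along $R''\circ R'$ with respect to $R$ and $\mu$.
   Context: A complete commutative residuated lattice is a complete lattice $(L,\preceq)$ with a commutative monoid $(1,\cdot)$ such that each $p\cdot(-)$ has a right adjoint $p\Rightarrow(-)$: $p\cdot q\preceq r$ iff $q\preceq(p\Rightarrow r)$. An $L$-enriched category $X$ is a set with $X(-,-)\colon X\times X\to L$ satisfying $1\preceq X(x,x)$ and $X(y,z)\cdot X(x,y)\preceq X(x,z)$. An $L$-enriched functor $F\colon X\to Y$ is a function with $X(x,x')\preceq Y(Fx,Fx')$. $L$ is an $L$-enriched category with $L(p,q)=(p\Rightarrow q)$; $L^{X}$ is the set of $L$-enriched functors $X\to L$ with $L^{X}(\mu,\nu)=\bigwedge_x(\mu x\Rightarrow\nu x)$. For an $L$-enriched functor $S\colon X\to B$, $S^{*}\colon L^{B}\to L^{X}$ is $S^{*}\nu=\nu\circ S$; the $L$-enriched upper approximation $\overline{S}\colon L^{X}\to L^{B}$ is the left $L$-enriched adjoint of $S^{*}$ and the lower approximation $\underline{S}$ the right $L$-enriched adjoint (where $F\colon X\to Y$ is left $L$-enriched adjoint to $G\colon Y\to X$ if $Y(Fx,y)=X(x,Gy)$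 for all $x,y$). Given $S\colon X\to B$ and $\mu\in L^{X}$, $B$ is reducible to $B'$ along an $L$-enriched functor $T\colon B\to B'$ (with respect to $S$ and $\mu$) if $T^{*}(\overline{T\circ S}\,\mu)=\overline{S}\mu$ and $T^{*}(\underline{T\circ S}\,\mu)=\underline{S}\mu$. *)

theory Defs
  imports Main "HOL-Library.FuncSet"
begin

text \<open>
  The underlying set of the complete commutative residuated lattice is a whole type
  (a complete lattice is never empty). The right adjoint of multiplication by p is
  determined by the adjunction law.
\<close>

class complete_comm_residuated_lattice = complete_lattice + comm_monoid_mult +
  fixes residuum :: "'a \<Rightarrow> 'a \<Rightarrow> 'a"  (infixr "\<leadsto>" 60)
  assumes residuation: "p * q \<le> r \<longleftrightarrow> q \<le> (p \<leadsto> r)"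

text \<open>
  Enriched categories have an explicit set of objects, which may be empty. Values of
  hom outside the objects are irrelevant.
\<close>

record ('x, 'l) enriched_graph =
  obj :: "'x set"
  hom :: "'x \<Rightarrow> 'x \<Rightarrow> 'l"

definition enriched_category ::
  "('x, 'l::complete_comm_residuated_lattice) enriched_graph \<Rightarrow> bool" where
  "enriched_category X \<longleftrightarrow>
     (\<forall>x\<in>obj X. 1 \<le> hom X x x) \<and>
     (\<forall>x\<in>obj X. \<forall>y\<in>obj X. \<forall>z\<in>obj X. hom X y z * hom X x y \<le> hom X x z)"

text \<open>
  A function between sets of objects is represented by the HOL function that is
  undefined outside its domain, so that equality of HOL functions is equality of
  functors; accordingly composites are formed with \<^const>\<open>compose\<close>.
\<close>

definition enriched_functor ::
  "('x, 'l::complete_comm_residuated_lattice) enriched_graph \<Rightarrow> ('y, 'l) enriched_graph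
     \<Rightarrow> ('x \<Rightarrow> 'y) \<Rightarrow> bool" where
  "enriched_functor X Y F \<longleftrightarrow>
     F \<in> obj X \<rightarrow>\<^sub>E obj Y \<and>
     (\<forall>x\<in>obj X. \<forall>x'\<in>obj X. hom X x x' \<le> hom Y (F x) (F x'))"

definition base_category :: "('l::complete_comm_residuated_lattice, 'l) enriched_graph" where
  "base_category = \<lparr>obj = UNIV, hom = (\<leadsto>)\<rparr>"

definition functor_category ::
  "('x, 'l::complete_comm_residuated_lattice) enriched_graph \<Rightarrow> ('x \<Rightarrow> 'l, 'l) enriched_graph"
  where
  "functor_category X =
     \<lparr>obj = {\<mu>. enriched_functor X base_category \<mu>},
      hom = (\<lambda>\<mu> \<nu>. INF x\<in>obj X. \<mu> x \<leadsto> \<nu> x)\<rparr>"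

definition left_enriched_adjoint ::
  "('x, 'l::complete_comm_residuated_lattice) enriched_graph \<Rightarrow> ('y, 'l) enriched_graph
     \<Rightarrow> ('x \<Rightarrow> 'y) \<Rightarrow> ('y \<Rightarrow> 'x) \<Rightarrow> bool" where
  "left_enriched_adjoint X Y F G \<longleftrightarrow>
     enriched_functor X Y F \<and> enriched_functor Y X G \<and>
     (\<forall>x\<in>obj X. \<forall>y\<in>obj Y. hom Y (F x) y = hom X x (G y))"

definition pullback ::
  "('x, 'l::complete_comm_residuated_lattice) enriched_graph \<Rightarrow> ('b, 'l) enriched_graph
     \<Rightarrow> ('x \<Rightarrow> 'b) \<Rightarrow> ('b \<Rightarrow> 'l) \<Rightarrow> ('x \<Rightarrow> 'l)" where
  "pullback X B S = (\<lambda>\<nu>\<in>obj (functor_category B). compose (obj X) \<nu> S)"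

text \<open>
  The descriptions below denote: existence and uniqueness of both adjoints are the
  facts \<open>upper_approx_unique\<close> and \<open>lower_approx_unique\<close>.
\<close>

definition upper_approx ::
  "('x, 'l::complete_comm_residuated_lattice) enriched_graph \<Rightarrow> ('b, 'l) enriched_graph
     \<Rightarrow> ('x \<Rightarrow> 'b) \<Rightarrow> ('x \<Rightarrow> 'l) \<Rightarrow> ('b \<Rightarrow> 'l)" where
  "upper_approx X B S =
     (THE F. left_enriched_adjoint (functor_category X) (functor_category B) F (pullback X B S))"

definition lower_approx ::
  "('x, 'l::complete_comm_residuated_lattice) enriched_graph \<Rightarrow> ('b, 'l) enriched_graph
     \<Rightarrow> ('x \<Rightarrow> 'b) \<Rightarrow> ('x \<Rightarrow> 'l) \<Rightarrow> ('b \<Rightarrow> 'l)" where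
  "lower_approx X B S =
     (THE G. left_enriched_adjoint (functor_category B) (functor_category X) (pullback X B S) G)"

definition reducible ::
  "('x, 'l::complete_comm_residuated_lattice) enriched_graph \<Rightarrow> ('b, 'l) enriched_graph
     \<Rightarrow> ('c, 'l) enriched_graph \<Rightarrow> ('x \<Rightarrow> 'b) \<Rightarrow> ('x \<Rightarrow> 'l) \<Rightarrow> ('b \<Rightarrow> 'c) \<Rightarrow> bool" where
  "reducible X B B' S \<mu> T \<longleftrightarrow>
     enriched_functor B B' T \<and>
     pullback B B' T (upper_approx X B' (compose (obj X) T S) \<mu>) = upper_approx X B S \<mu> \<and>
     pullback B B' T (lower_approx X B' (compose (obj X) T S) \<mu>) = lower_approx X B S \<mu>"


context complete_comm_residuated_lattice
begin

lemma residuum_mp: "p * (p \<leadsto> r) \<le> r"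
  by (simp add: residuation)

lemma mult_left_le: "a \<le> b \<Longrightarrow> c * a \<le> c * b"
proof -
  assume "a \<le> b"
  also have "b \<le> (c \<leadsto> c * b)" by (simp add: residuation[symmetric])
  finally show "c * a \<le> c * b" by (simp add: residuation)
qed

lemma mult_right_le: "a \<le> b \<Longrightarrow> a * c \<le> b * c"
  using mult_left_le[of a b c] by (simp add: mult.commute)

lemma residuum_trans: "(q \<leadsto> r) * (p \<leadsto> q) \<le> (p \<leadsto> r)"
proof -
  have "p * ((q \<leadsto> r) * (p \<leadsto> q)) = (p * (p \<leadsto> q)) * (q \<leadsto> r)"
    by (simp add: mult_ac)
  also have "\<dots> \<le> q * (q \<leadsto> r)" by (intro mult_right_le residuum_mp)
  also have "\<dots> \<le> r" by (rule residuum_mp)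
  finally show ?thesis by (simp add: residuation)
qed

lemma residuum_antimono: "p \<le> q \<Longrightarrow> (q \<leadsto> r) \<le> (p \<leadsto> r)"
  using order.trans[OF mult_right_le[of p q "q \<leadsto> r"] residuum_mp] by (simp add: residuation)

lemma one_le_residuum: "1 \<le> (p \<leadsto> q) \<longleftrightarrow> p \<le> q"
  by (simp add: residuation[symmetric])

end

lemma obj_functor_category:
  "\<mu> \<in> obj (functor_category X) \<longleftrightarrow>
     \<mu> \<in> extensional (obj X) \<and> (\<forall>x\<in>obj X. \<forall>y\<in>obj X. hom X x y * \<mu> x \<le> \<mu> y)"
  by (auto simp: functor_category_def enriched_functor_def base_category_def PiE_def
      residuation mult.commute)

lemma le_hom_functor_category:
  "l \<le> hom (functor_category X) \<mu> \<nu> \<longleftrightarrow> (\<forall>x\<in>obj X. \<mu> x * l \<le> \<nu> x)"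
  by (simp add: functor_category_def le_INF_iff residuation)

lemma functor_category_antisym:
  assumes "\<mu> \<in> obj (functor_category X)" "\<nu> \<in> obj (functor_category X)"
    and "1 \<le> hom (functor_category X) \<mu> \<nu>" "1 \<le> hom (functor_category X) \<nu> \<mu>"
  shows "\<mu> = \<nu>"
  using assms unfolding le_hom_functor_category
  by (intro extensionalityI[of _ "obj X"]) (auto simp: obj_functor_category intro: antisym)

lemma functor_category_refl: "1 \<le> hom (functor_category X) \<mu> \<mu>"
  by (simp add: le_hom_functor_category)

lemma functor_category_trans:
  "hom (functor_category X) \<nu> \<kappa> * hom (functor_category X) \<mu> \<nu> \<le> hom (functor_category X) \<mu> \<kappa>"
  unfolding le_hom_functor_category
proof
  fix x assume x: "x \<in> obj X"
  let ?p = "hom (functor_category X) \<nu> \<kappa>" and ?q = "hom (functor_category X) \<mu> \<nu>"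
  have "\<mu> x * (?p * ?q) = (\<mu> x * ?q) * ?p" by (simp add: mult_ac)
  also have "\<dots> \<le> \<nu> x * ?p" 
    using x le_hom_functor_category[of ?q X \<mu> \<nu>] by (intro mult_right_le) simp
  also have "\<dots> \<le> \<kappa> x" using x le_hom_functor_category[of ?p X \<nu> \<kappa>] by simp
  finally show "\<mu> x * (?p * ?q) \<le> \<kappa> x" .
qed

lemma enriched_category_base: "enriched_category base_category"
  by (simp add: enriched_category_def base_category_def one_le_residuum residuum_trans)

lemma enriched_category_functor_category: "enriched_category (functor_category X)"
  by (simp add: enriched_category_def functor_category_refl functor_category_trans)

lemma enriched_functor_pullback:
  assumes S: "enriched_functor X B S"
  shows "enriched_functor (functor_category B) (functor_category X) (pullback X B S)"
proof -
  have SB: "S x \<in> obj B" if "x \<in> obj X" for x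
    using S that by (auto simp: enriched_functor_def)
  have Sm: "hom X x y \<le> hom B (S x) (S y)" if "x \<in> obj X" "y \<in> obj X" for x y
    using S that by (auto simp: enriched_functor_def)
  have "compose (obj X) \<nu> S \<in> obj (functor_category X)" if "\<nu> \<in> obj (functor_category B)" for \<nu>
    unfolding obj_functor_category
  proof (intro conjI ballI)
    show "compose (obj X) \<nu> S \<in> extensional (obj X)" by simp
    fix x y assume x: "x \<in> obj X" and y: "y \<in> obj X"
    have "hom X x y * \<nu> (S x) \<le> hom B (S x) (S y) * \<nu> (S x)"
      using Sm x y by (intro mult_right_le)
    also have "\<dots> \<le> \<nu> (S y)" using that SB x y by (simp add: obj_functor_category)
    finally show "hom X x y * compose (obj X) \<nu> S x \<le> compose (obj X) \<nu> S y"
      using x y by (simp add: compose_def)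
  qed
  moreover have "hom (functor_category B) \<nu> \<kappa>
      \<le> hom (functor_category X) (compose (obj X) \<nu> S) (compose (obj X) \<kappa> S)" for \<nu> \<kappa>
    using le_hom_functor_category[of "hom (functor_category B) \<nu> \<kappa>" B \<nu> \<kappa>] SB
    by (simp add: le_hom_functor_category[of _ X] compose_def)
  ultimately show ?thesis
    by (auto simp: enriched_functor_def pullback_def)
qed

lemma left_adjoint_functorial:
  assumes G: "enriched_functor Y (functor_category X) G"
    and Y: "\<And>y. y \<in> obj Y \<Longrightarrow> 1 \<le> hom Y y y"
    and F: "F \<in> obj (functor_category X) \<rightarrow>\<^sub>E obj Y"
    and adj: "\<And>x y. x \<in> obj (functor_category X) \<Longrightarrow> y \<in> obj Y \<Longrightarrow>
      hom Y (F x) y = hom (functor_category X) x (G y)"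
  shows "left_enriched_adjoint (functor_category X) Y F G"
proof -
  let ?X = "functor_category X"
  have "hom ?X x x' \<le> hom Y (F x) (F x')" if x: "x \<in> obj ?X" "x' \<in> obj ?X" for x x'
  proof -
    have "1 \<le> hom Y (F x') (F x')" using F x Y by auto
    also have "\<dots> = hom ?X x' (G (F x'))" using PiE_mem[OF F] x by (simp add: adj)
    finally have "1 * hom ?X x x' \<le> hom ?X x' (G (F x')) * hom ?X x x'" by (rule mult_right_le)
    also have "\<dots> \<le> hom ?X x (G (F x'))" by (rule functor_category_trans)
    also have "\<dots> = hom Y (F x) (F x')" using PiE_mem[OF F] x by (simp add: adj)
    finally show ?thesis by simp
  qed
  with assms show ?thesis by (auto simp: left_enriched_adjoint_def enriched_functor_def)
qed

lemma right_adjoint_functorial: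
  assumes F: "enriched_functor Y (functor_category X) F"
    and Y: "\<And>y. y \<in> obj Y \<Longrightarrow> 1 \<le> hom Y y y"
    and G: "G \<in> obj (functor_category X) \<rightarrow>\<^sub>E obj Y"
    and adj: "\<And>x y. x \<in> obj (functor_category X) \<Longrightarrow> y \<in> obj Y \<Longrightarrow>
      hom (functor_category X) (F y) x = hom Y y (G x)"
  shows "left_enriched_adjoint Y (functor_category X) F G"
proof -
  let ?X = "functor_category X"
  have "hom ?X x x' \<le> hom Y (G x) (G x')" if x: "x \<in> obj ?X" "x' \<in> obj ?X" for x x'
  proof -
    have "1 \<le> hom Y (G x) (G x)" using G x Y by auto
    also have "\<dots> = hom ?X (F (G x)) x" using PiE_mem[OF G] x by (simp add: adj)
    finally have "hom ?X x x' * 1 \<le> hom ?X x x' * hom ?X (F (G x)) x" by (rule mult_left_le)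
    also have "\<dots> \<le> hom ?X (F (G x)) x'" by (rule functor_category_trans)
    also have "\<dots> = hom Y (G x) (G x')" using PiE_mem[OF G] x by (simp add: adj)
    finally show ?thesis by simp
  qed
  with assms show ?thesis by (auto simp: left_enriched_adjoint_def enriched_functor_def)
qed

lemma upper_approx_unique:
  assumes B: "enriched_category B" and S: "enriched_functor X B S"
  shows "\<exists>!F. left_enriched_adjoint (functor_category X) (functor_category B) F (pullback X B S)"
proof (rule ex_ex1I)
  have SB: "S x \<in> obj B" if "x \<in> obj X" for x
    using S that by (auto simp: enriched_functor_def)
  have Sm: "hom X x y \<le> hom B (S x) (S y)" if "x \<in> obj X" "y \<in> obj X" for x y
    using S that by (auto simp: enriched_functor_def)
  have B1: "1 \<le> hom B b b" if "b \<in> obj B" for b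
    using B that by (auto simp: enriched_category_def)
  have B2: "hom B b c * hom B a b \<le> hom B a c" if "a \<in> obj B" "b \<in> obj B" "c \<in> obj B" for a b c
    using B that by (auto simp: enriched_category_def)
  define U where "U = (\<lambda>\<mu>\<in>obj (functor_category X). \<lambda>b\<in>obj B. SUP x\<in>obj X. hom B (S x) b * \<mu> x)"
  have U: "U \<mu> b = (SUP x\<in>obj X. hom B (S x) b * \<mu> x)"
    if "\<mu> \<in> obj (functor_category X)" "b \<in> obj B" for \<mu> b
    using that by (simp add: U_def)
  have Uobj: "U \<mu> \<in> obj (functor_category B)" if m: "\<mu> \<in> obj (functor_category X)" for \<mu>
    unfolding obj_functor_category
  proof (intro conjI ballI)
    show "U \<mu> \<in> extensional (obj B)" using m by (simp add: U_def)
    fix b c assume b: "b \<in> obj B" and c: "c \<in> obj B"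
    have "hom B (S x) b * \<mu> x \<le> (hom B b c \<leadsto> U \<mu> c)" if x: "x \<in> obj X" for x
    proof -
      have "hom B b c * (hom B (S x) b * \<mu> x) = (hom B b c * hom B (S x) b) * \<mu> x"
        by (simp add: mult_ac)
      also have "\<dots> \<le> hom B (S x) c * \<mu> x" using B2 SB x b c by (intro mult_right_le) auto
      also have "\<dots> \<le> U \<mu> c" using U[OF m c] x by (auto intro: SUP_upper)
      finally show ?thesis by (simp add: residuation)
    qed
    then have "U \<mu> b \<le> (hom B b c \<leadsto> U \<mu> c)" by (simp add: U[OF m b] SUP_least)
    then show "hom B b c * U \<mu> b \<le> U \<mu> c" by (simp add: residuation)
  qed
  have adj: "hom (functor_category B) (U \<mu>) \<nu> = hom (functor_category X) \<mu> (pullback X B S \<nu>)"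
    if m: "\<mu> \<in> obj (functor_category X)" and n: "\<nu> \<in> obj (functor_category B)" for \<mu> \<nu>
  proof -
    have "l \<le> hom (functor_category B) (U \<mu>) \<nu> \<longleftrightarrow>
        l \<le> hom (functor_category X) \<mu> (pullback X B S \<nu>)" for l
    proof -
      have p: "pullback X B S \<nu> x = \<nu> (S x)" if "x \<in> obj X" for x
        using n that by (simp add: pullback_def compose_def)
      have "l \<le> hom (functor_category B) (U \<mu>) \<nu> \<longleftrightarrow>
          (\<forall>b\<in>obj B. U \<mu> b \<le> (l \<leadsto> \<nu> b))"
        by (simp add: le_hom_functor_category residuation[symmetric] mult.commute)
      also have "\<dots> \<longleftrightarrow> (\<forall>b\<in>obj B. \<forall>x\<in>obj X. hom B (S x) b * \<mu> x \<le> (l \<leadsto> \<nu> b))"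
        using U[OF m] by (simp add: SUP_le_iff)
      also have "\<dots> \<longleftrightarrow> (\<forall>x\<in>obj X. \<mu> x * l \<le> \<nu> (S x))"
      proof (intro iffI ballI)
        fix x assume h: "\<forall>b\<in>obj B. \<forall>x\<in>obj X. hom B (S x) b * \<mu> x \<le> (l \<leadsto> \<nu> b)" and x: "x \<in> obj X"
        have "1 * \<mu> x \<le> hom B (S x) (S x) * \<mu> x" using B1 SB x by (intro mult_right_le) auto
        also have "\<dots> \<le> (l \<leadsto> \<nu> (S x))" using h x SB by blast
        finally show "\<mu> x * l \<le> \<nu> (S x)" by (simp add: residuation[symmetric] mult.commute)
      next
        fix b x assume h: "\<forall>x\<in>obj X. \<mu> x * l \<le> \<nu> (S x)" and b: "b \<in> obj B" and x: "x \<in> obj X"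
        have "l * (hom B (S x) b * \<mu> x) = hom B (S x) b * (\<mu> x * l)" by (simp add: mult_ac)
        also have "\<dots> \<le> hom B (S x) b * \<nu> (S x)" using h x by (intro mult_left_le) auto
        also have "\<dots> \<le> \<nu> b" using n SB x b by (auto simp: obj_functor_category)
        finally show "hom B (S x) b * \<mu> x \<le> (l \<leadsto> \<nu> b)" by (simp add: residuation)
      qed
      also have "\<dots> \<longleftrightarrow> l \<le> hom (functor_category X) \<mu> (pullback X B S \<nu>)"
        by (simp add: le_hom_functor_category p)
      finally show ?thesis .
    qed
    then show ?thesis using order.refl by (blast intro: antisym)
  qed
  have "U \<in> obj (functor_category X) \<rightarrow>\<^sub>E obj (functor_category B)"
    using Uobj by (auto simp: U_def)
  then have "left_enriched_adjoint (functor_category X) (functor_category B) U (pullback X B S)"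
    by (intro left_adjoint_functorial enriched_functor_pullback S functor_category_refl adj)
  then show "\<exists>F. left_enriched_adjoint (functor_category X) (functor_category B) F (pullback X B S)" by blast
next
  fix F F'
  assume F: "left_enriched_adjoint (functor_category X) (functor_category B) F (pullback X B S)"
    and F': "left_enriched_adjoint (functor_category X) (functor_category B) F' (pullback X B S)"
  show "F = F'"
  proof (rule extensionalityI[of _ "obj (functor_category X)"])
    show "F \<in> extensional (obj (functor_category X))" "F' \<in> extensional (obj (functor_category X))"
      using F F' by (auto simp: left_enriched_adjoint_def enriched_functor_def PiE_def)
    fix \<mu> assume m: "\<mu> \<in> obj (functor_category X)"
    have o: "F \<mu> \<in> obj (functor_category B)" "F' \<mu> \<in> obj (functor_category B)"
      using F F' m by (auto simp: left_enriched_adjoint_def enriched_functor_def)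
    have "hom (functor_category B) (F \<mu>) \<nu> = hom (functor_category B) (F' \<mu>) \<nu>"
      if "\<nu> \<in> obj (functor_category B)" for \<nu>
      using F F' m that by (simp add: left_enriched_adjoint_def)
    then show "F \<mu> = F' \<mu>"
      using o functor_category_refl[of B "F \<mu>"] functor_category_refl[of B "F' \<mu>"]
      by (intro functor_category_antisym[of _ B]) simp_all
  qed
qed

lemma lower_approx_unique:
  assumes B: "enriched_category B" and S: "enriched_functor X B S"
  shows "\<exists>!G. left_enriched_adjoint (functor_category B) (functor_category X) (pullback X B S) G"
proof (rule ex_ex1I)
  have SB: "S x \<in> obj B" if "x \<in> obj X" for x
    using S that by (auto simp: enriched_functor_def)
  have B1: "1 \<le> hom B b b" if "b \<in> obj B" for b
    using B that by (auto simp: enriched_category_def)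
  have B2: "hom B b c * hom B a b \<le> hom B a c" if "a \<in> obj B" "b \<in> obj B" "c \<in> obj B" for a b c
    using B that by (auto simp: enriched_category_def)
  define D where "D = (\<lambda>\<mu>\<in>obj (functor_category X). \<lambda>b\<in>obj B. INF x\<in>obj X. hom B b (S x) \<leadsto> \<mu> x)"
  have D: "D \<mu> b = (INF x\<in>obj X. hom B b (S x) \<leadsto> \<mu> x)"
    if "\<mu> \<in> obj (functor_category X)" "b \<in> obj B" for \<mu> b
    using that by (simp add: D_def)
  have leD: "l \<le> D \<mu> b \<longleftrightarrow> (\<forall>x\<in>obj X. hom B b (S x) * l \<le> \<mu> x)"
    if "\<mu> \<in> obj (functor_category X)" "b \<in> obj B" for \<mu> b l
    using D[OF that] by (simp add: le_INF_iff residuation)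
  have Dobj: "D \<mu> \<in> obj (functor_category B)" if m: "\<mu> \<in> obj (functor_category X)" for \<mu>
    unfolding obj_functor_category
  proof (intro conjI ballI)
    show "D \<mu> \<in> extensional (obj B)" using m by (simp add: D_def)
    fix b c assume b: "b \<in> obj B" and c: "c \<in> obj B"
    show "hom B b c * D \<mu> b \<le> D \<mu> c"
      unfolding leD[OF m c]
    proof
      fix x assume x: "x \<in> obj X"
      have "hom B c (S x) * (hom B b c * D \<mu> b) = (hom B c (S x) * hom B b c) * D \<mu> b"
        by (simp add: mult_ac)
      also have "\<dots> \<le> hom B b (S x) * D \<mu> b" using B2 SB x b c by (intro mult_right_le) auto
      also have "\<dots> \<le> \<mu> x" using leD[OF m b] x by blast
      finally show "hom B c (S x) * (hom B b c * D \<mu> b) \<le> \<mu> x" .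
    qed
  qed
  have adj: "hom (functor_category X) (pullback X B S \<nu>) \<mu> = hom (functor_category B) \<nu> (D \<mu>)"
    if m: "\<mu> \<in> obj (functor_category X)" and n: "\<nu> \<in> obj (functor_category B)" for \<mu> \<nu>
  proof -
    have "l \<le> hom (functor_category X) (pullback X B S \<nu>) \<mu> \<longleftrightarrow>
        l \<le> hom (functor_category B) \<nu> (D \<mu>)" for l
    proof -
      have p: "pullback X B S \<nu> x = \<nu> (S x)" if "x \<in> obj X" for x
        using n that by (simp add: pullback_def compose_def)
      have "l \<le> hom (functor_category X) (pullback X B S \<nu>) \<mu> \<longleftrightarrow>
          (\<forall>x\<in>obj X. \<nu> (S x) * l \<le> \<mu> x)"
        by (simp add: le_hom_functor_category p)
      also have "\<dots> \<longleftrightarrow> (\<forall>b\<in>obj B. \<forall>x\<in>obj X. hom B b (S x) * (\<nu> b * l) \<le> \<mu> x)"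
      proof (intro iffI ballI)
        fix b x assume h: "\<forall>x\<in>obj X. \<nu> (S x) * l \<le> \<mu> x" and b: "b \<in> obj B" and x: "x \<in> obj X"
        have "hom B b (S x) * \<nu> b \<le> \<nu> (S x)" using n SB x b by (auto simp: obj_functor_category)
        then have "(hom B b (S x) * \<nu> b) * l \<le> \<nu> (S x) * l" by (rule mult_right_le)
        also have "\<dots> \<le> \<mu> x" using h x by blast
        finally show "hom B b (S x) * (\<nu> b * l) \<le> \<mu> x" by (simp add: mult_ac)
      next
        fix x assume h: "\<forall>b\<in>obj B. \<forall>x\<in>obj X. hom B b (S x) * (\<nu> b * l) \<le> \<mu> x"
          and x: "x \<in> obj X"
        have "1 * (\<nu> (S x) * l) \<le> hom B (S x) (S x) * (\<nu> (S x) * l)"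
          using B1 SB x by (intro mult_right_le) auto
        also have "\<dots> \<le> \<mu> x" using h x SB by blast
        finally show "\<nu> (S x) * l \<le> \<mu> x" by simp
      qed
      also have "\<dots> \<longleftrightarrow> l \<le> hom (functor_category B) \<nu> (D \<mu>)"
        using leD[OF m] by (simp add: le_hom_functor_category)
      finally show ?thesis .
    qed
    then show ?thesis using order.refl by (blast intro: antisym)
  qed
  have "D \<in> obj (functor_category X) \<rightarrow>\<^sub>E obj (functor_category B)"
    using Dobj by (auto simp: D_def)
  then have "left_enriched_adjoint (functor_category B) (functor_category X) (pullback X B S) D"
    by (intro right_adjoint_functorial enriched_functor_pullback S functor_category_refl adj)
  then show "\<exists>G. left_enriched_adjoint (functor_category B) (functor_category X) (pullback X B S) G" by blast
next
  fix G G'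
  assume G: "left_enriched_adjoint (functor_category B) (functor_category X) (pullback X B S) G"
    and G': "left_enriched_adjoint (functor_category B) (functor_category X) (pullback X B S) G'"
  show "G = G'"
  proof (rule extensionalityI[of _ "obj (functor_category X)"])
    show "G \<in> extensional (obj (functor_category X))" "G' \<in> extensional (obj (functor_category X))"
      using G G' by (auto simp: left_enriched_adjoint_def enriched_functor_def PiE_def)
    fix \<mu> assume m: "\<mu> \<in> obj (functor_category X)"
    have o: "G \<mu> \<in> obj (functor_category B)" "G' \<mu> \<in> obj (functor_category B)"
      using G G' m by (auto simp: left_enriched_adjoint_def enriched_functor_def)
    have "hom (functor_category B) \<nu> (G \<mu>) = hom (functor_category B) \<nu> (G' \<mu>)"
      if "\<nu> \<in> obj (functor_category B)" for \<nu>
      using G G' m that by (simp add: left_enriched_adjoint_def)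
    then show "G \<mu> = G' \<mu>"
      using o functor_category_refl[of B "G \<mu>"] functor_category_refl[of B "G' \<mu>"]
      by (intro functor_category_antisym[of _ B]) simp_all
  qed
qed

lemma upper_approx_adjoint:
  assumes "enriched_category B" "enriched_functor X B S"
  shows "left_enriched_adjoint (functor_category X) (functor_category B)
    (upper_approx X B S) (pullback X B S)"
  unfolding upper_approx_def by (rule theI'[OF upper_approx_unique[OF assms]])

lemma lower_approx_adjoint:
  assumes "enriched_category B" "enriched_functor X B S"
  shows "left_enriched_adjoint (functor_category B) (functor_category X)
    (pullback X B S) (lower_approx X B S)"
  unfolding lower_approx_def by (rule theI'[OF lower_approx_unique[OF assms]])

end

theory Submission
  imports Defs
begin

text \<open>Pullback is contravariantly functorial: pulling back along \<open>R''\<close> after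
  \<open>R'\<close> is pulling back along \<open>R''\<close> and then along \<open>R'\<close>
  (\<open>pullback_compose\<close>). By associativity, both the second reducibility and the goal
  speak of the same approximation on \<open>A''\<close>. Its pullback along \<open>R''\<close> is
  the approximation on \<open>A'\<close>, whose pullback along \<open>R'\<close> is the one on
  \<open>A\<close>. The argument is identical for upper and lower approximations; the adjunctions
  serve only to place these in the functor category.\<close>

lemma enriched_functor_mem:
  "enriched_functor X Y F \<Longrightarrow> x \<in> obj X \<Longrightarrow> F x \<in> obj Y"
  by (auto simp: enriched_functor_def)

lemma enriched_functor_compose:
  assumes F: "enriched_functor X Y F" and G: "enriched_functor Y Z G"
  shows "enriched_functor X Z (compose (obj X) G F)"
proof -
  have "hom X x x' \<le> hom Z (G (F x)) (G (F x'))" if x: "x \<in> obj X" "x' \<in> obj X" for x x'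
  proof -
    have "hom X x x' \<le> hom Y (F x) (F x')"
      using F x by (auto simp: enriched_functor_def)
    also have "\<dots> \<le> hom Z (G (F x)) (G (F x'))"
      using G enriched_functor_mem[OF F] x by (auto simp: enriched_functor_def)
    finally show ?thesis .
  qed
  then show ?thesis
    using enriched_functor_mem[OF F] enriched_functor_mem[OF G]
    by (auto simp: enriched_functor_def compose_def)
qed

text \<open>Both sides precompose \<nu> with \<open>S\<close> followed by \<open>T\<close>; they
  agree as HOL functions because \<open>S\<close> lands in \<open>obj Y\<close>, where the
  restricted composites take their true values.\<close>

lemma pullback_compose:
  assumes S: "enriched_functor X Y S" and T: "enriched_functor Y Z T"
    and \<nu>: "\<nu> \<in> obj (functor_category Z)"
  shows "pullback X Y S (pullback Y Z T \<nu>) = pullback X Z (compose (obj X) T S) \<nu>"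
proof -
  \<comment> \<open>\<open>pullback X Y S\<close> is \<open>undefined\<close> off the objects of
    \<open>functor_category Y\<close>, so its argument must be shown to be one.\<close>
  have "pullback Y Z T \<nu> \<in> obj (functor_category Y)"
    using enriched_functor_mem[OF enriched_functor_pullback[OF T] \<nu>] .
  then show ?thesis
    using \<nu> enriched_functor_mem[OF S] by (auto simp: pullback_def compose_def)
qed

text \<open>Supplies the membership premise of \<open>pullback_compose\<close>: a left adjoint is
  itself an enriched functor into \<open>functor_category B\<close>.\<close>

lemma upper_approx_mem:
  assumes "enriched_category B" "enriched_functor X B S" "\<mu> \<in> obj (functor_category X)"
  shows "upper_approx X B S \<mu> \<in> obj (functor_category B)"
  using upper_approx_adjoint[OF assms(1,2)]
  by (auto simp: left_enriched_adjoint_def intro: enriched_functor_mem[OF _ assms(3)])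

lemma lower_approx_mem:
  assumes "enriched_category B" "enriched_functor X B S" "\<mu> \<in> obj (functor_category X)"
  shows "lower_approx X B S \<mu> \<in> obj (functor_category B)"
  using lower_approx_adjoint[OF assms(1,2)]
  by (auto simp: left_enriched_adjoint_def intro: enriched_functor_mem[OF _ assms(3)])

theorem theorem10:
  fixes X :: "('x, 'l::complete_comm_residuated_lattice) enriched_graph"
    and A :: "('a, 'l) enriched_graph"
    and A' :: "('b, 'l) enriched_graph"
    and A'' :: "('c, 'l) enriched_graph"
    and R :: "'x \<Rightarrow> 'a" and R' :: "'a \<Rightarrow> 'b" and R'' :: "'b \<Rightarrow> 'c"
    and \<mu> :: "'x \<Rightarrow> 'l"
  assumes "enriched_category X" and "enriched_category A"
    and "enriched_category A'" and "enriched_category A''"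
    and "enriched_functor X A R" and "enriched_functor A A' R'" and "enriched_functor A' A'' R''"
    and "enriched_functor X base_category \<mu>"
    and "reducible X A A' R \<mu> R'"
    and "reducible X A' A'' (compose (obj X) R' R) \<mu> R''"
  shows "reducible X A A'' R \<mu> (compose (obj A) R'' R')"
proof -
  note R = assms(5) and R' = assms(6) and R'' = assms(7)
  note red' = assms(9)[unfolded reducible_def] and red'' = assms(10)[unfolded reducible_def]
  let ?S = "compose (obj X) R'' (compose (obj X) R' R)"
  have S: "enriched_functor X A'' ?S"
    by (intro enriched_functor_compose[OF _ R''] enriched_functor_compose[OF R R'])
  \<comment> \<open>Associativity of \<open>compose\<close> needs \<open>R\<close> to map into
    \<open>obj A\<close>, the domain to which the inner composite is restricted.\<close>
  have S_eq: "compose (obj X) (compose (obj A) R'' R') R = ?S"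
    using enriched_functor_mem[OF R] by (intro compose_assoc[symmetric]) auto
  have \<mu>: "\<mu> \<in> obj (functor_category X)"
    using assms(8) by (simp add: functor_category_def)
  show ?thesis
    unfolding reducible_def S_eq
    \<comment> \<open>In each instance of \<open>pullback_compose\<close>, \<open>red''\<close>
      evaluates the inner pullback and \<open>red'\<close> the outer one.\<close>
    using enriched_functor_compose[OF R' R''] red' red''
      pullback_compose[OF R' R'' upper_approx_mem[OF assms(4) S \<mu>]]
      pullback_compose[OF R' R'' lower_approx_mem[OF assms(4) S \<mu>]]
    by simp
qed

end
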